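(* Let $k\ge 1$, let $\Sigma$ be a finite non-empty alphabet, let $u,v\in\Sigma^{k-1}$, and let $w\in\Sigma^*$ be a word of length at least $k$ that begins with $u$ and ends with $v$. Let $\Delta$ be the Laplacian of the directed multigraph $G_{\Psi_k(w)}$, and let $\Delta(v)$ be the matrix obtained from $\Delta$ by removing the row and the column corresponding to the vertex $v$. Then $$|[w]_k|=\det(\Delta(v))\prod_{x\in F_{k-1}(w)}\frac{(|w|_x-1)!}{\prod_{a\in\Sigma}|w|_{xa}!}.$$
   Context: For a word $w$ and a non-empty word $x$, $|w|_x$ is the number of occurrences (overlapping ones included) of $x$ as a factor of $w$; for the empty word $\varepsilon$ one sets $|w|_\varepsilon=|w|+1$, where $|w|$ is the length of $w$. $F_{k-1}(w)$ is the set of factors of $w$ of length $k-1$. Two words are $k$-abelian equivalent, $u\sim_k v$, if $|u|_x=|v|_x$ for all non-empty words $x$ of length at most $k$; $[w]_k$ is the class of $w$ under $\sim_k$. $\Psi_k(w)\in\mathbb{N}^{\Sigma^k}$ is the vector with $\Psi_k(w)[z]=|w|_z$ for $z\in\Sigma^k$. For $f\in\mathbb{N}^{\Sigma^k}$, the directed multigraph $G_f$ (loops allowed) has as vertices all words $x\in\Sigma^{k-1}$ that are a prefix or a suffix of some $z\in\Sigma^k$ with $f[z]>0$; for each $z\in\Sigma^k$ with $f[z]>0$ there is an edge of multiplicity $f[z]$ from the length $k-1$ prefix of $z$ to the length $k-1$ suffix of $z$ (for $k=1$ the only vertex is $\varepsilon$ and all edges are loops). For a directed multigraph $G$ with $m(p,q)$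 the number of edges from $p$ to $q$ and $d^+(p)$ the number of edges leaving $p$ (loops included), the Laplacian $\Delta$ is the matrix indexed by the vertices with $\Delta_{pq}=-m(p,q)$ if $p\ne q$ and $\Delta_{pp}=d^+(p)-m(p,p)$. The determinant of the empty matrix is $1$. *)

theory Defs
  imports
    "HOL-Library.Sublist"
    "Graph_Theory.Digraph"
    "Jordan_Normal_Form.Determinant"
begin

(* Words over the alphabet are lists over a type of class finite (always non-empty). *)

(* An occurrence of x in w is a factorisation w = p @ x @ s.  The empty word then has
   length w + 1 occurrences; see occ_Nil. *)
definition occ :: "'a list \<Rightarrow> 'a list \<Rightarrow> nat" where
  "occ w x = card {(p, s). w = p @ x @ s}"

lemma occ_Nil: "occ w [] = length w + 1"
proof -
  have "bij_betw (\<lambda>i. (take i w, drop i w)) {..length w} {(p, s). w = p @ [] @ s}"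
    by (rule bij_betwI[where g = "\<lambda>(p, s). length p"]) auto
  from bij_betw_same_card[OF this] show ?thesis
    by (simp add: occ_def)
qed

definition factors :: "nat \<Rightarrow> 'a list \<Rightarrow> 'a list set" where
  "factors n w = {x. length x = n \<and> sublist x w}"

definition k_abelian_equiv :: "nat \<Rightarrow> 'a list \<Rightarrow> 'a list \<Rightarrow> bool" where
  "k_abelian_equiv k u v \<longleftrightarrow>
     (\<forall>x. x \<noteq> [] \<and> length x \<le> k \<longrightarrow> occ u x = occ v x)"

definition k_abelian_class :: "nat \<Rightarrow> 'a list \<Rightarrow> 'a list set" where
  "k_abelian_class k w = {w'. k_abelian_equiv k w w'}"

(* A vector indexed by the words of length k is a function on all words;
   only its values at words of length k are meaningful. *)
definition parikh :: "nat \<Rightarrow> 'a list \<Rightarrow> 'a list \<Rightarrow> nat" where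
  "parikh k w = (\<lambda>z. if length z = k then occ w z else 0)"

(* The f z parallel edges of a word z are the pairs (z, i) with i < f z.  For length z = k \<ge> 1,
   butlast z and tl z are the prefix and the suffix of z of length k - 1. *)
definition word_multigraph ::
  "nat \<Rightarrow> ('a list \<Rightarrow> nat) \<Rightarrow> ('a list, 'a list \<times> nat) pre_digraph" where
  "word_multigraph k f =
     \<lparr> verts = {x. length x = k - 1 \<and>
                  (\<exists>z. length z = k \<and> f z > 0 \<and> (prefix x z \<or> suffix x z))},
       arcs = {(z, i). length z = k \<and> i < f z},
       tail = (\<lambda>(z, i). butlast z),
       head = (\<lambda>(z, i). tl z) \<rparr>"

definition arc_mult :: "('v, 'e) pre_digraph \<Rightarrow> 'v \<Rightarrow> 'v \<Rightarrow> nat" where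
  "arc_mult G p q = card {e \<in> arcs G. tail G e = p \<and> head G e = q}"

definition laplacian :: "('v, 'e) pre_digraph \<Rightarrow> 'v \<Rightarrow> 'v \<Rightarrow> int" where
  "laplacian G p q =
     (if p = q then int (out_degree G p) - int (arc_mult G p p) else - int (arc_mult G p q))"

(* The Laplacian as a matrix, for a listing vs of the vertices without repetitions. *)
definition laplacian_mat :: "('v, 'e) pre_digraph \<Rightarrow> 'v list \<Rightarrow> int mat" where
  "laplacian_mat G vs =
     mat (length vs) (length vs) (\<lambda>(i, j). laplacian G (vs ! i) (vs ! j))"

end

theory Submission
  imports Defs "Graph_Theory.Arc_Walk" "HOL-Combinatorics.Multiset_Permutations"
begin

text \<open>
A word \<open>w\<close> of length at least \<open>k\<close> is a walk in the de Bruijn graph: its vertices are the factors of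
length \<open>k - 1\<close>, its arcs the factors of length \<open>k\<close>. An occurrence of a short factor can be extended
letter by letter until it has length \<open>k\<close> or meets the end of the word. Hence the counts up to length
\<open>k\<close> carry the same information as the counts at length \<open>k\<close> together with the prefix and the suffix of
length \<open>k - 1\<close> (\<open>k_abelian_equiv_iff\<close>), and the class of \<open>w\<close> corresponds to the walks from \<open>u\<close> to \<open>v\<close>
that use each arc as often as \<open>w\<close> does (\<open>k_abelian_class_eq_trails\<close>). These are the Eulerian trails
of the multigraph of \<open>w\<close>, with parallel arcs not told apart.

Eulerian trails are counted by the BEST theorem and the matrix-tree theorem. Here both are replaced
by a single induction that never mentions trees. Let \<open>T\<close> be the number of trails from \<open>u\<close> to \<open>v\<close> with
arc multiset \<open>M\<close>, where the in- and outdegrees satisfy the balance condition of such trails. Then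
\<open>T\<close> times the factorials of all multiplicities equals the determinant of the Laplacian with the root
\<open>v\<close> removed, times the factorial of the outdegree of \<open>v\<close>, times the factorials of the outdegrees minus
one of the other vertices (\<open>card_trails_formula\<close>). Removing the first arc of a trail changes the
Laplacian in the row of \<open>u\<close> only, and the recurrence for \<open>T\<close> becomes linearity of the determinant in
this row. The multigraph may fall apart when arcs are removed; then no trail exists and the determinant
vanishes, so the formula persists.

Finally, each occurrence of \<open>x\<close> in \<open>w\<close> is followed by a letter except for the last one of \<open>v\<close>.
So \<open>|w|\<^sub>x - 1\<close> is the outdegree of \<open>x\<close> if \<open>x = v\<close> and the outdegree minus one otherwise, which turns the
factorials above into the product of the claim.
\<close>

section \<open>Determinants and multisets\<close>

lemma cofactor_eqI:
  assumes "A \<in> carrier_mat n n" "B \<in> carrier_mat n n" "i < n" "j < n"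
    and "\<And>k l. k < n \<Longrightarrow> l < n \<Longrightarrow> k \<noteq> i \<Longrightarrow> l \<noteq> j \<Longrightarrow> A $$ (k, l) = B $$ (k, l)"
  shows "mat_delete A i j = mat_delete B i j" "cofactor A i j = cofactor B i j"
proof -
  show "mat_delete A i j = mat_delete B i j"
    by (rule eq_matI) (use assms in \<open>auto simp: mat_delete_def\<close>)
  then show "cofactor A i j = cofactor B i j"
    by (simp add: cofactor_def)
qed

text \<open>The cofactors along a row do not see that row, so all matrices that differ only in row \<open>i\<close> can be
expanded with the same cofactors. This makes the determinant visibly linear in that row, which is
the only form of multilinearity that is used below.\<close>

lemma det_expand_common_row:
  fixes A B :: "'a::comm_ring_1 mat"
  assumes "A \<in> carrier_mat n n" "B \<in> carrier_mat n n" "i < n"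
    and "\<And>k l. k < n \<Longrightarrow> l < n \<Longrightarrow> k \<noteq> i \<Longrightarrow> A $$ (k, l) = B $$ (k, l)"
  shows "det B = (\<Sum>j<n. B $$ (i, j) * cofactor A i j)"
proof -
  have "cofactor B i j = cofactor A i j" if "j < n" for j
    by (rule cofactor_eqI(2)[of _ n]) (use assms that in auto)
  then show ?thesis
    using laplace_expansion_row[OF assms(2,3)] by simp
qed

lemma size_filter_mset_eq_sum:
  "size {#x \<in># M. P x#} = (\<Sum>x | x \<in># M \<and> P x. count M x)"
  by (simp add: size_multiset_overloaded_eq)

lemma sum_of_bool_eq_mult:
  fixes f :: "'a \<Rightarrow> 'b::semiring_1"
  assumes "finite A" "i \<in> A"
  shows "(\<Sum>k\<in>A. of_bool (k = i) * f k) = f i"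
  by (subst sum.remove[OF assms]) (auto intro: sum.neutral)

text \<open>The number of ways to permute the copies of each element among themselves: a sequence over the
multiset \<open>M\<close> becomes this many sequences once equal elements are told apart.\<close>

definition parallel_orders :: "'b multiset \<Rightarrow> int" where
  "parallel_orders M = (\<Prod>e\<in>set_mset M. fact (count M e))"

lemma parallel_orders_minus:
  assumes "e \<in># M"
  shows "parallel_orders M = int (count M e) * parallel_orders (M - {#e#})"
proof -
  have fin: "finite (set_mset M)" by simp
  have "parallel_orders (M - {#e#}) = (\<Prod>d\<in>set_mset M. fact (count (M - {#e#}) d))"
    unfolding parallel_orders_def
    by (rule prod.mono_neutral_left) (auto simp: in_diff_count not_in_iff dest: in_diffD)
  also have "\<dots> = fact (count M e - 1) * (\<Prod>d\<in>set_mset M - {e}. fact (count M d))"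
    using assms by (subst prod.remove[OF fin assms]) (auto intro!: prod.cong split: if_splits)
  finally have "int (count M e) * parallel_orders (M - {#e#}) =
      int (count M e) * fact (count M e - 1) * (\<Prod>d\<in>set_mset M - {e}. fact (count M d))"
    by simp
  also have "int (count M e) * fact (count M e - 1) = fact (count M e)"
    using assms by (simp add: fact_reduce)
  also have "fact (count M e) * (\<Prod>d\<in>set_mset M - {e}. fact (count M d)) = parallel_orders M"
    unfolding parallel_orders_def by (subst prod.remove[OF fin assms]) auto
  finally show ?thesis ..
qed

section \<open>Counting trails by a Laplacian determinant\<close>

context pre_digraph begin

text \<open>A multigraph is given by a multiset \<open>M\<close> of arcs of a fixed graph \<open>G\<close>, so that parallel arcs are
indistinguishable.\<close>

definition outdeg :: "'b multiset \<Rightarrow> 'a \<Rightarrow> nat" where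
  "outdeg M x = size {#e \<in># M. tail G e = x#}"

definition indeg :: "'b multiset \<Rightarrow> 'a \<Rightarrow> nat" where
  "indeg M x = size {#e \<in># M. head G e = x#}"

definition arcs_between :: "'b multiset \<Rightarrow> 'a \<Rightarrow> 'a \<Rightarrow> nat" where
  "arcs_between M x y = size {#e \<in># M. tail G e = x \<and> head G e = y#}"

definition trails :: "'b multiset \<Rightarrow> 'a \<Rightarrow> 'a \<Rightarrow> 'b list set" where
  "trails M u v = {es. mset es = M \<and> cas u es v}"

text \<open>The degree condition which every trail from \<open>u\<close> to \<open>v\<close> imposes on its arcs. Deleting the
first arc keeps it, with the start moved to the head of the arc. Connectedness may be lost on the
way; then no trail exists, and both sides of the counting formula are zero.\<close>

definition balanced :: "'b multiset \<Rightarrow> 'a \<Rightarrow> 'a \<Rightarrow> bool" where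
  "balanced M u v \<longleftrightarrow> (\<forall>x. outdeg M x + of_bool (v = x) = indeg M x + of_bool (u = x))"

text \<open>The Laplacian in which the row of \<open>v\<close> and the rows of the vertices without outgoing arcs are
replaced by unit rows. As a unit row has the effect of deleting the row and the column, the
determinant is that of the Laplacian of the vertices with outgoing arcs, with \<open>v\<close> removed. The
point of the encoding is that the size of the matrix stays the same while the arcs of \<open>M\<close> are
removed one at a time and vertices lose their last outgoing arc.\<close>

definition rooted_laplacian :: "'b multiset \<Rightarrow> 'a \<Rightarrow> 'a \<Rightarrow> 'a \<Rightarrow> int" where
  "rooted_laplacian M v x y =
     (if x = v \<or> outdeg M x = 0 then of_bool (x = y)
      else int (outdeg M x) * of_bool (x = y) - int (arcs_between M x y))"

definition rooted_laplacian_mat :: "'b multiset \<Rightarrow> 'a \<Rightarrow> 'a list \<Rightarrow> int mat" where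
  "rooted_laplacian_mat M v vs =
     mat (length vs) (length vs) (\<lambda>(i, j). rooted_laplacian M v (vs ! i) (vs ! j))"

lemma rooted_laplacian_mat_carrier [simp]:
  "rooted_laplacian_mat M v vs \<in> carrier_mat (length vs) (length vs)"
  by (simp add: rooted_laplacian_mat_def)

lemma rooted_laplacian_mat_index [simp]:
  "i < length vs \<Longrightarrow> j < length vs \<Longrightarrow>
     rooted_laplacian_mat M v vs $$ (i, j) = rooted_laplacian M v (vs ! i) (vs ! j)"
  by (simp add: rooted_laplacian_mat_def)

lemma finite_trails: "finite (trails M u v)"
  by (rule finite_subset[OF _ finite_permutations_of_multiset[of M]])
    (auto simp: trails_def permutations_of_multiset_def)

lemma outdeg_minus:
  "e \<in># M \<Longrightarrow> outdeg (M - {#e#}) x = outdeg M x - of_bool (tail G e = x)"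
  by (auto simp: outdeg_def size_Diff_singleton)

lemma outdeg_add: "outdeg (add_mset e M) x = outdeg M x + of_bool (tail G e = x)"
  and indeg_add: "indeg (add_mset e M) x = indeg M x + of_bool (head G e = x)"
  and arcs_between_add: "arcs_between (add_mset e M) x y = arcs_between M x y + of_bool (tail G e = x \<and> head G e = y)"
  by (auto simp: outdeg_def indeg_def arcs_between_def)

lemma outdeg_pos: "e \<in># M \<Longrightarrow> outdeg M (tail G e) > 0"
  by (auto simp: outdeg_add dest!: multi_member_split)

lemma balanced_add:
  "balanced (add_mset e M) (tail G e) v \<longleftrightarrow> balanced M (head G e) v"
  unfolding balanced_def outdeg_add indeg_add
  by (intro iff_allI) linarith

lemma cas_imp_balanced: "cas u es v \<Longrightarrow> balanced (mset es) u v"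
proof (induction es arbitrary: u)
  case Nil
  then show ?case by (simp add: balanced_def outdeg_def indeg_def)
next
  case (Cons e es)
  then show ?case using balanced_add[of e "mset es" v] by auto
qed

lemma trails_unfold:
  assumes "M \<noteq> {#} \<or> u \<noteq> v"
  shows "trails M u v =
    (\<Union>e\<in>{e. e \<in># M \<and> tail G e = u}. (#) e ` trails (M - {#e#}) (head G e) v)"
proof (intro equalityI subsetI)
  fix es assume *: "es \<in> trails M u v"
  with assms obtain e fs where es: "es = e # fs"
    by (cases es) (auto simp: trails_def)
  with * show "es \<in> (\<Union>e\<in>{e. e \<in># M \<and> tail G e = u}. (#) e ` trails (M - {#e#}) (head G e) v)"
    by (auto simp: trails_def)
qed (auto simp: trails_def)

lemma card_trails:
  assumes "M \<noteq> {#} \<or> u \<noteq> v"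
  shows "card (trails M u v) =
    (\<Sum>e | e \<in># M \<and> tail G e = u. card (trails (M - {#e#}) (head G e) v))"
  unfolding trails_unfold[OF assms]
  by (subst card_UN_disjoint)
     (auto simp: finite_trails card_image)

text \<open>Classifying trails by their first arc. The weight \<open>parallel_orders\<close> turns the sum over the distinct
arcs that leave \<open>u\<close> into one in which each arc counts with its multiplicity, so that degrees and
rows of the Laplacian appear as weighted sums over these arcs.\<close>

lemma weighted_card_trails:
  assumes "M \<noteq> {#} \<or> u \<noteq> v"
  shows "int (card (trails M u v)) * parallel_orders M =
    (\<Sum>e | e \<in># M \<and> tail G e = u.
       int (count M e) * (int (card (trails (M - {#e#}) (head G e) v)) * parallel_orders (M - {#e#})))"
  unfolding card_trails[OF assms] of_nat_sum sum_distrib_right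
  by (intro sum.cong refl) (simp add: parallel_orders_minus[of _ M] mult_ac)

text \<open>In the BEST theorem this counts, for a fixed spanning tree of last exits towards \<open>v\<close>, the orders
in which a trail can use the remaining exits of each vertex. A vertex without outgoing arcs
contributes the factor \<open>1\<close>, because the subtraction is truncated.\<close>

definition exit_orders :: "'a set \<Rightarrow> 'b multiset \<Rightarrow> 'a \<Rightarrow> int" where
  "exit_orders V M v = fact (outdeg M v) * (\<Prod>x\<in>V - {v}. fact (outdeg M x - 1))"

lemma sum_count_outdeg: "(\<Sum>e | e \<in># M \<and> tail G e = u. int (count M e)) = int (outdeg M u)"
  by (simp add: outdeg_def size_filter_mset_eq_sum)

lemma sum_count_arcs_between:
  "(\<Sum>e | e \<in># M \<and> tail G e = u. int (count M e) * of_bool (head G e = y)) = int (arcs_between M u y)"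
proof -
  have "int (arcs_between M u y) = (\<Sum>e\<in>{e. (e \<in># M \<and> tail G e = u) \<and> head G e = y}. int (count M e))"
    by (simp add: arcs_between_def size_filter_mset_eq_sum conj_assoc)
  also have "\<dots> = (\<Sum>e\<in>{e. e \<in># M \<and> tail G e = u}. int (count M e) * of_bool (head G e = y))"
    by (rule sum.mono_neutral_cong_left) auto
  finally show ?thesis ..
qed

lemma sum_arcs_between:
  assumes "finite V" "\<And>e. e \<in># M \<Longrightarrow> head G e \<in> V"
  shows "(\<Sum>y\<in>V. int (arcs_between M x y)) = int (outdeg M x)"
proof -
  have "(\<Sum>y\<in>V. int (arcs_between M x y)) =
    (\<Sum>e | e \<in># M \<and> tail G e = x. \<Sum>y\<in>V. int (count M e) * of_bool (head G e = y))"
    unfolding sum_count_arcs_between[symmetric] by (rule sum.swap)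
  also have "\<dots> = (\<Sum>e | e \<in># M \<and> tail G e = x. int (count M e))"
    by (rule sum.cong) (use assms in \<open>auto simp: of_bool_def sum.delta' if_distrib cong: if_cong\<close>)
  finally show ?thesis by (simp add: sum_count_outdeg)
qed

lemma arcs_between_eq_0_if_indeg: "indeg M y = 0 \<Longrightarrow> arcs_between M x y = 0"
  by (auto simp: indeg_def arcs_between_def filter_mset_eq_conv filter_mset_eq_mempty_iff)

lemma rooted_laplacian_minus_other:
  assumes "e \<in># M" "x \<noteq> tail G e \<or> x = v"
  shows "rooted_laplacian (M - {#e#}) v x y = rooted_laplacian M v x y"
proof -
  obtain N where "M = add_mset e N" using assms(1) by (metis insert_DiffM)
  then show ?thesis using assms(2) by (auto simp: rooted_laplacian_def outdeg_add arcs_between_add)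
qed

lemma rooted_laplacian_minus_tail:
  assumes "e \<in># M" "tail G e \<noteq> v" "outdeg M (tail G e) \<ge> 2"
  shows "rooted_laplacian (M - {#e#}) v (tail G e) y =
    rooted_laplacian M v (tail G e) y - of_bool (tail G e = y) + of_bool (head G e = y)"
proof -
  obtain N where "M = add_mset e N" using assms(1) by (metis insert_DiffM)
  then show ?thesis using assms(2,3) by (auto simp: rooted_laplacian_def outdeg_add arcs_between_add)
qed

text \<open>A form of the BEST theorem, with a determinant in place of the number of spanning trees. The proof
is by induction on the number of arcs, removing the first arc \<open>e\<close> of the trail. It leaves \<open>u\<close>, so
only the row of \<open>u\<close> and the degree of \<open>u\<close> change, and the sum over \<open>e\<close> is evaluated by linearity of
the determinant in that row. With \<open>d\<close> the outdegree of \<open>u\<close>, there are four cases.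

\<^item> \<open>u = v\<close> and \<open>d = 0\<close>: as \<open>M\<close> is non-empty there is no trail. All degrees are balanced, so the
  vertices with outgoing arcs are closed under arcs and their Laplacian has row sums zero.
\<^item> \<open>u = v\<close> and \<open>d > 0\<close>: the matrix does not change at all, and the \<open>d\<close> choices of \<open>e\<close> account for
  \<open>d! = d * (d - 1)!\<close>.
\<^item> \<open>u \<noteq> v\<close> and \<open>d = 1\<close>: by balance no arc enters \<open>u\<close>. Hence the column of \<open>u\<close> is a unit column
  before the removal, and the row of \<open>u\<close> is a unit row afterwards; both determinants are the
  cofactor at \<open>u\<close>.
\<^item> \<open>u \<noteq> v\<close> and \<open>d \<ge> 2\<close>: removing \<open>e\<close> subtracts the row of \<open>e\<close>, which has \<open>1\<close> at the tail and \<open>-1\<close> at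
  the head (and is zero for a loop), from the row \<open>r\<close> of \<open>u\<close>. As \<open>r\<close> is the sum of these rows over all \<open>e\<close>, summing the new
  rows gives \<open>d r - r = (d - 1) r\<close>, and \<open>(d - 1) * (d - 2)! = (d - 1)!\<close>.\<close>

theorem card_trails_formula:
  assumes "distinct vs" "u \<in> set vs" "v \<in> set vs"
    and "\<And>e. e \<in># M \<Longrightarrow> tail G e \<in> set vs \<and> head G e \<in> set vs"
    and "balanced M u v"
  shows "int (card (trails M u v)) * parallel_orders M =
    det (rooted_laplacian_mat M v vs) * exit_orders (set vs) M v"
  using assms(2,4,5)
proof (induction "size M" arbitrary: M u)
  case 0
  then have M: "M = {#}" by simp
  with 0 have "u = v" by (auto simp: balanced_def outdeg_def indeg_def of_bool_def split: if_splits)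
  have "rooted_laplacian_mat M v vs = 1\<^sub>m (length vs)"
    by (rule eq_matI)
      (use assms(1) in \<open>auto simp: M rooted_laplacian_def outdeg_def rooted_laplacian_mat_def nth_eq_iff_index_eq\<close>)
  moreover have "trails M u v = {[]}" by (auto simp: M trails_def \<open>u = v\<close>)
  ultimately show ?case
    by (simp add: M parallel_orders_def exit_orders_def outdeg_def)
next
  case (Suc n)
  let ?n = "length vs"
  let ?L = "\<lambda>M. rooted_laplacian_mat M v vs"
  let ?E = "{e. e \<in># M \<and> tail G e = u}"
  have ne: "M \<noteq> {#}" using Suc.hyps(2) by auto
  have IH: "int (card (trails (M - {#e#}) (head G e) v)) * parallel_orders (M - {#e#}) =
      det (?L (M - {#e#})) * exit_orders (set vs) (M - {#e#}) v" if "e \<in> ?E" for e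
  proof (rule Suc.hyps(1))
    show "n = size (M - {#e#})" using that Suc.hyps(2) by (simp add: size_Diff_singleton)
    show "head G e \<in> set vs" using that Suc.prems by auto
    show "tail G e' \<in> set vs \<and> head G e' \<in> set vs" if "e' \<in># M - {#e#}" for e'
      using that Suc.prems(2) by (auto dest: in_diffD)
    show "balanced (M - {#e#}) (head G e) v"
      using Suc.prems(3) that balanced_add[of e "M - {#e#}" v] by auto
  qed
  have step: "int (card (trails M u v)) * parallel_orders M =
    (\<Sum>e\<in>?E. int (count M e) * (det (?L (M - {#e#})) * exit_orders (set vs) (M - {#e#}) v))"
    using ne IH by (simp add: weighted_card_trails)
  obtain i where i: "i < ?n" "vs ! i = u"
    using Suc.prems(1) by (auto simp: in_set_conv_nth)
  have eq_i: "vs ! k = u \<longleftrightarrow> k = i" if "k < ?n" for k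
    using that i assms(1) by (auto simp: nth_eq_iff_index_eq)
  consider (stop) "u = v" "outdeg M v = 0" | (leave_root) "u = v" "outdeg M v > 0"
    | (last_exit) "u \<noteq> v" "outdeg M u = 1" | (exit) "u \<noteq> v" "outdeg M u \<ge> 2"
  proof -
    have "outdeg M u > 0" if "u \<noteq> v"
      using Suc.prems(3)[unfolded balanced_def, rule_format, of u] that by simp
    then have "u = v \<and> outdeg M v = 0 \<or> u = v \<and> outdeg M v > 0 \<or>
        u \<noteq> v \<and> outdeg M u = 1 \<or> u \<noteq> v \<and> outdeg M u \<ge> 2" by linarith
    then show ?thesis using that by blast
  qed
  then show ?case
  proof cases
    case stop
    then have E: "?E = {}" using outdeg_pos by fastforce
    \<comment> \<open>The kernel vector is the indicator of the vertices with outgoing arcs.\<close>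
    define y where "y = vec ?n (\<lambda>j. of_bool (outdeg M (vs ! j) > 0) :: int)"
    have deg: "outdeg M x = indeg M x" for x
      using Suc.prems(3) stop by (auto simp: balanced_def)
    have "?L M *\<^sub>v y = 0\<^sub>v ?n"
    proof (rule eq_vecI)
      fix j assume "j < dim_vec (0\<^sub>v ?n :: int vec)"
      then have j: "j < ?n" by simp
      let ?x = "vs ! j"
      have "(?L M *\<^sub>v y) $ j = (\<Sum>k<?n. rooted_laplacian M v ?x (vs ! k) * of_bool (outdeg M (vs ! k) > 0))"
        using j by (simp add: y_def scalar_prod_def rooted_laplacian_mat_def lessThan_atLeast0)
      also have "\<dots> = (\<Sum>z\<in>set vs. rooted_laplacian M v ?x z * of_bool (outdeg M z > 0))"
        by (rule sum.reindex_bij_betw, rule bij_betw_nth) (use assms(1) in auto)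
      also have "\<dots> = 0"
      proof (cases "?x = v \<or> outdeg M ?x = 0")
        case True
        then have "outdeg M ?x = 0" using stop by auto
        then show ?thesis by (intro sum.neutral) (auto simp: rooted_laplacian_def)
      next
        case False
        then have "rooted_laplacian M v ?x z * of_bool (outdeg M z > 0) =
           int (outdeg M ?x) * of_bool (?x = z) - int (arcs_between M ?x z)" for z
          using deg[of z] arcs_between_eq_0_if_indeg[of M z] by (auto simp: rooted_laplacian_def)
        then have "(\<Sum>z\<in>set vs. rooted_laplacian M v ?x z * of_bool (outdeg M z > 0)) =
           (\<Sum>z\<in>set vs. int (outdeg M ?x) * of_bool (?x = z)) - (\<Sum>z\<in>set vs. int (arcs_between M ?x z))"
          by (simp add: sum_subtractf)
        also have "(\<Sum>z\<in>set vs. int (outdeg M ?x) * of_bool (?x = z)) = int (outdeg M ?x)"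
          using j by (auto simp: of_bool_def sum.delta' if_distrib cong: if_cong)
        finally show ?thesis using sum_arcs_between[of "set vs" M ?x] Suc.prems(2) by simp
      qed
      finally show "(?L M *\<^sub>v y) $ j = 0\<^sub>v ?n $ j" using j by simp
    qed (simp add: rooted_laplacian_mat_def)
    moreover have "y \<noteq> 0\<^sub>v ?n"
    proof -
      obtain e where e: "e \<in># M" using ne by auto
      then obtain j where "j < ?n" "vs ! j = tail G e"
        using Suc.prems(2) by (metis in_set_conv_nth)
      then have "y $ j = 1" using outdeg_pos[OF e] by (simp add: y_def)
      then show ?thesis using \<open>j < ?n\<close> by auto
    qed
    moreover have "y \<in> carrier_vec ?n" by (simp add: y_def)
    ultimately have "det (?L M) = 0"
      using det_0_iff_vec_prod_zero[of "?L M" ?n] by auto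
    then show ?thesis unfolding step E by simp
  next
    case leave_root
    have "det (?L (M - {#e#})) * exit_orders (set vs) (M - {#e#}) v =
       det (?L M) * (fact (outdeg M v - 1) * (\<Prod>x\<in>set vs - {v}. fact (outdeg M x - 1)))"
      if "e \<in> ?E" for e
    proof -
      have "?L (M - {#e#}) = ?L M"
        by (rule eq_matI) (use that leave_root(1) in
          \<open>auto simp: rooted_laplacian_mat_def rooted_laplacian_minus_other\<close>)
      then show ?thesis
        using that leave_root(1) by (auto simp: exit_orders_def outdeg_minus of_bool_def intro!: prod.cong split: if_splits)
    qed
    then have "int (card (trails M u v)) * parallel_orders M =
       (\<Sum>e\<in>?E. int (count M e)) *
       (det (?L M) * (fact (outdeg M v - 1) * (\<Prod>x\<in>set vs - {v}. fact (outdeg M x - 1))))"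
      unfolding step by (simp add: sum_distrib_right)
    also have "\<dots> = det (?L M) * ((int (outdeg M v) * fact (outdeg M v - 1)) *
         (\<Prod>x\<in>set vs - {v}. fact (outdeg M x - 1)))"
      unfolding sum_count_outdeg leave_root(1) by (simp add: mult_ac)
    also have "int (outdeg M v) * fact (outdeg M v - 1) = fact (outdeg M v)"
      using leave_root by (simp add: fact_reduce)
    finally show ?thesis by (simp add: exit_orders_def)
  next
    case last_exit
    \<comment> \<open>The outdegree \<open>1\<close> at the starting vertex leaves no room for an entering arc.\<close>
    have ind: "indeg M u = 0"
      using Suc.prems(3)[unfolded balanced_def, rule_format, of u] last_exit by simp
    have detL: "det (?L M) = cofactor (?L M) i i"
    proof -
      have "det (?L M) = (\<Sum>k<?n. ?L M $$ (k, i) * cofactor (?L M) k i)"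
        by (rule laplace_expansion_column[OF _ i(1)]) simp
      also have "\<dots> = (\<Sum>k<?n. of_bool (k = i) * cofactor (?L M) k i)"
      proof (rule sum.cong[OF refl])
        fix k assume "k \<in> {..<?n}"
        then have "?L M $$ (k, i) = of_bool (k = i)"
          using i(1) last_exit arcs_between_eq_0_if_indeg[OF ind]
          by (cases "k = i") (simp_all add: i(2) eq_i rooted_laplacian_def)
        then show "?L M $$ (k, i) * cofactor (?L M) k i = of_bool (k = i) * cofactor (?L M) k i"
          by simp
      qed
      finally show ?thesis using i by (simp add: sum_of_bool_eq_mult)
    qed
    have "det (?L (M - {#e#})) * exit_orders (set vs) (M - {#e#}) v =
       det (?L M) * exit_orders (set vs) M v" if "e \<in> ?E" for e
    proof -
      have "det (?L (M - {#e#})) = (\<Sum>j<?n. ?L (M - {#e#}) $$ (i, j) * cofactor (?L M) i j)"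
        by (rule det_expand_common_row)
           (use that i eq_i in \<open>auto simp: rooted_laplacian_minus_other\<close>)
      also have "\<dots> = (\<Sum>j<?n. of_bool (j = i) * cofactor (?L M) i j)"
      proof (rule sum.cong[OF refl])
        fix j assume "j \<in> {..<?n}"
        then have "?L (M - {#e#}) $$ (i, j) = of_bool (j = i)"
          using i last_exit that eq_i[of j]
          by (cases "j = i") (simp_all add: rooted_laplacian_def outdeg_minus)
        then show "?L (M - {#e#}) $$ (i, j) * cofactor (?L M) i j = of_bool (j = i) * cofactor (?L M) i j"
          by simp
      qed
      also have "\<dots> = det (?L M)" using i detL by (simp add: sum_of_bool_eq_mult)
      finally show ?thesis
        using that last_exit by (auto simp: exit_orders_def outdeg_minus of_bool_def intro!: prod.cong split: if_splits)
    qed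
    then have "int (card (trails M u v)) * parallel_orders M =
       (\<Sum>e\<in>?E. int (count M e)) * (det (?L M) * exit_orders (set vs) M v)"
      unfolding step by (simp add: sum_distrib_right)
    then show ?thesis unfolding sum_count_outdeg using last_exit by simp
  next
    case exit
    let ?d = "int (outdeg M u)"
    \<comment> \<open>The factors of \<open>exit_orders\<close> that do not involve the degree of \<open>u\<close>.\<close>
    define R where "R = fact (outdeg M v) * (\<Prod>x\<in>set vs - {v} - {u}. fact (outdeg M x - 1) :: int)"
    have split: "exit_orders (set vs) N v =
        fact (outdeg N v) * (fact (outdeg N u - 1) * (\<Prod>x\<in>set vs - {v} - {u}. fact (outdeg N x - 1)))" for N
      unfolding exit_orders_def
      by (subst prod.remove[of _ u]) (use exit Suc.prems(1) in auto)
    have order: "exit_orders (set vs) (M - {#e#}) v = fact (outdeg M u - 2) * R" if "e \<in> ?E" for e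
      using that exit unfolding split R_def
      by (auto simp: outdeg_minus numeral_2_eq_2 intro!: prod.cong)
    have orderM: "exit_orders (set vs) M v = (?d - 1) * (fact (outdeg M u - 2) * R)"
    proof -
      have "fact (outdeg M u - 1) = (?d - 1) * fact (outdeg M u - 2)"
        using exit by (subst fact_reduce) (auto simp: numeral_2_eq_2 of_nat_diff)
      then show ?thesis unfolding split R_def by simp
    qed
    have "(\<Sum>e\<in>?E. int (count M e) * det (?L (M - {#e#}))) =
      (\<Sum>e\<in>?E. \<Sum>j<?n. (int (count M e) * (?L M $$ (i, j) - of_bool (j = i)) +
          int (count M e) * of_bool (head G e = vs ! j)) * cofactor (?L M) i j)"
    proof (rule sum.cong[OF refl])
      fix e assume e: "e \<in> ?E"
      have "det (?L (M - {#e#})) = (\<Sum>j<?n. ?L (M - {#e#}) $$ (i, j) * cofactor (?L M) i j)"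
        by (rule det_expand_common_row)
           (use e i eq_i in \<open>auto simp: rooted_laplacian_minus_other\<close>)
      also have "\<dots> = (\<Sum>j<?n. (?L M $$ (i, j) - of_bool (j = i) + of_bool (head G e = vs ! j)) *
            cofactor (?L M) i j)"
      proof (rule sum.cong[OF refl])
        fix j assume "j \<in> {..<?n}"
        then have "?L (M - {#e#}) $$ (i, j) =
            ?L M $$ (i, j) - of_bool (j = i) + of_bool (head G e = vs ! j)"
          using e exit i(1) eq_i[of j] rooted_laplacian_minus_tail[of e M v "vs ! j"]
          by (simp add: i(2) eq_commute[of u])
        then show "?L (M - {#e#}) $$ (i, j) * cofactor (?L M) i j =
            (?L M $$ (i, j) - of_bool (j = i) + of_bool (head G e = vs ! j)) * cofactor (?L M) i j"
          by simp
      qed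
      finally show "int (count M e) * det (?L (M - {#e#})) =
        (\<Sum>j<?n. (int (count M e) * (?L M $$ (i, j) - of_bool (j = i)) +
          int (count M e) * of_bool (head G e = vs ! j)) * cofactor (?L M) i j)"
        by (simp only: sum_distrib_left distrib_left mult.assoc distrib_right)
    qed
    also have "\<dots> = (\<Sum>j<?n. (?d * (?L M $$ (i, j) - of_bool (j = i)) + int (arcs_between M u (vs ! j))) *
        cofactor (?L M) i j)"
      by (subst sum.swap)
         (simp only: sum_distrib_right[symmetric] sum.distrib sum_count_outdeg sum_count_arcs_between)
    also have "\<dots> = (\<Sum>j<?n. (?d - 1) * (?L M $$ (i, j) * cofactor (?L M) i j))"
    proof (rule sum.cong[OF refl])
      fix j assume "j \<in> {..<?n}"
      then have "?L M $$ (i, j) = ?d * of_bool (j = i) - int (arcs_between M u (vs ! j))"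
        using i(1) exit eq_i[of j] by (simp add: i(2) eq_commute[of u] rooted_laplacian_def)
      then have "?d * (?L M $$ (i, j) - of_bool (j = i)) + int (arcs_between M u (vs ! j)) =
          (?d - 1) * ?L M $$ (i, j)"
        by (simp only: right_diff_distrib left_diff_distrib)
      then show "(?d * (?L M $$ (i, j) - of_bool (j = i)) + int (arcs_between M u (vs ! j))) * cofactor (?L M) i j
        = (?d - 1) * (?L M $$ (i, j) * cofactor (?L M) i j)"
        by (simp only: mult.assoc)
    qed
    also have "\<dots> = (?d - 1) * det (?L M)"
      unfolding sum_distrib_left[symmetric]
      by (subst laplace_expansion_row[OF _ i(1)]) auto
    finally have *: "(\<Sum>e\<in>?E. int (count M e) * det (?L (M - {#e#}))) = (?d - 1) * det (?L M)" .
    have "int (card (trails M u v)) * parallel_orders M =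
       (\<Sum>e\<in>?E. int (count M e) * det (?L (M - {#e#}))) * (fact (outdeg M u - 2) * R)"
      unfolding step sum_distrib_right by (intro sum.cong refl) (simp add: order)
    then show ?thesis unfolding * orderM by (simp add: mult_ac)
  qed
qed

text \<open>Expanding along the unit row of the root turns the matrix into a principal minor, for any \<open>L\<close> that
shares the other rows.\<close>

lemma det_rooted_laplacian_mat:
  assumes "distinct vs" "i < length vs" "vs ! i = v"
    and "L \<in> carrier_mat (length vs) (length vs)"
    and "\<And>k l. k < length vs \<Longrightarrow> l < length vs \<Longrightarrow> k \<noteq> i \<Longrightarrow>
      rooted_laplacian M v (vs ! k) (vs ! l) = L $$ (k, l)"
  shows "det (rooted_laplacian_mat M v vs) = det (mat_delete L i i)"
proof -
  let ?R = "rooted_laplacian_mat M v vs"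
  have "det ?R = (\<Sum>j<length vs. ?R $$ (i, j) * cofactor ?R i j)"
    by (rule laplace_expansion_row) (use assms in auto)
  also have "\<dots> = (\<Sum>j<length vs. of_bool (j = i) * cofactor ?R i j)"
    using assms(1-3) by (intro sum.cong) (auto simp: rooted_laplacian_def nth_eq_iff_index_eq)
  also have "\<dots> = cofactor ?R i i"
    using assms(2) by (simp add: sum_of_bool_eq_mult)
  also have "\<dots> = cofactor L i i"
    by (rule cofactor_eqI(2)[of _ "length vs"]) (use assms in auto)
  finally show ?thesis by (simp add: cofactor_def)
qed

end

section \<open>Occurrences of factors and k-abelian equivalence\<close>

lemma finite_occurrences: "finite {(p, s). w = p @ x @ s}"
proof (rule finite_subset)
  show "{(p, s). w = p @ x @ s} \<subseteq> (\<lambda>i. (take i w, drop (i + length x) w)) ` {..length w}"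
  proof (rule subrelI)
    fix p s assume "(p, s) \<in> {(p, s). w = p @ x @ s}"
    then show "(p, s) \<in> (\<lambda>i. (take i w, drop (i + length x) w)) ` {..length w}"
      by (intro image_eqI[of _ _ "length p"]) auto
  qed
qed simp

lemma occ_empty_word: "occ [] x = of_bool (x = [])"
proof -
  have "{(p, s). [] = p @ x @ s} = (if x = [] then {([], [])} else {})" by auto
  then show ?thesis by (simp add: occ_def)
qed

lemma occ_Cons: "occ (a # w) x = occ w x + of_bool (prefix x (a # w))"
proof -
  let ?later = "(\<lambda>(p, s). (a # p, s)) ` {(p, s). w = p @ x @ s}"
  have "{(p, s). a # w = p @ x @ s} = ?later \<union> {(p, s). p = [] \<and> a # w = x @ s}"
    by (auto simp: Cons_eq_append_conv image_iff)
  moreover have "{(p, s). p = [] \<and> a # w = x @ s} =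
      (if prefix x (a # w) then {([], drop (length x) (a # w))} else {})"
    by (auto simp: prefix_def)
  moreover have "card ?later = occ w x"
    unfolding occ_def by (rule card_image) (auto simp: inj_on_def)
  moreover have "finite ?later" using finite_occurrences by blast
  ultimately show ?thesis
    unfolding occ_def by (auto simp: card_insert_if)
qed

lemma occ_pos_iff: "occ w x > 0 \<longleftrightarrow> sublist x w"
  unfolding occ_def by (auto simp: card_gt_0_iff finite_occurrences sublist_def)

text \<open>Every occurrence of \<open>x\<close> extends to the left by exactly one letter, unless it is at the very beginning.
So the counts of the words of length \<open>n\<close> and \<open>n + 1\<close> determine the prefix of length \<open>n\<close>; the next
lemma is the mirror image.\<close>

lemma occ_extend_left:
  fixes x :: "'a::finite list"
  shows "occ w x = (\<Sum>a\<in>UNIV. occ w (a # x)) + of_bool (prefix x w)"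
proof (induction w)
  case Nil
  then show ?case by (simp add: occ_empty_word)
next
  case (Cons b w)
  have "(\<Sum>a\<in>UNIV. occ (b # w) (a # x)) =
      (\<Sum>a\<in>UNIV. occ w (a # x)) + (\<Sum>a\<in>UNIV. of_bool (a = b \<and> prefix x w))"
    by (simp add: occ_Cons sum.distrib)
  also have "(\<Sum>a\<in>UNIV. of_bool (a = b \<and> prefix x w) :: nat) = of_bool (prefix x w)"
    by (cases "prefix x w") (simp_all add: of_bool_def)
  finally show ?case using Cons.IH by (simp add: occ_Cons[of b w x])
qed

lemma occ_extend_right:
  fixes x :: "'a::finite list"
  shows "occ w x = (\<Sum>a\<in>UNIV. occ w (x @ [a])) + of_bool (suffix x w)"
proof (induction w)
  case Nil
  then show ?case by (simp add: occ_empty_word)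
next
  case (Cons b w)
  let ?y = "b # w"
  have "(\<Sum>a\<in>UNIV. of_bool (prefix (x @ [a]) ?y) :: nat) = of_bool (strict_prefix x ?y)"
  proof (cases "strict_prefix x ?y")
    case True
    then obtain c s where "?y = x @ c # s" by (auto elim: strict_prefixE')
    then have "prefix (x @ [a]) ?y \<longleftrightarrow> a = c" for a by auto
    then show ?thesis using True by (simp add: of_bool_def)
  next
    case False
    then have "\<not> prefix (x @ [a]) ?y" for a
      by (auto simp: prefix_def strict_prefix_def)
    then show ?thesis using False by simp
  qed
  then have "(\<Sum>a\<in>UNIV. occ ?y (x @ [a])) =
      (\<Sum>a\<in>UNIV. occ w (x @ [a])) + of_bool (strict_prefix x ?y)"
    by (simp add: occ_Cons sum.distrib)
  moreover have "of_bool (strict_prefix x ?y) + of_bool (suffix x ?y) =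
      (of_bool (suffix x w) + of_bool (prefix x ?y) :: nat)"
    by (auto simp: suffix_Cons strict_prefix_def of_bool_def dest: suffix_length_le)
  ultimately show ?case using Cons.IH by (simp add: occ_Cons[of b w x])
qed

lemma suffix_iff_common_suffix:
  assumes "suffix v w" "length x \<le> length v"
  shows "suffix x w \<longleftrightarrow> suffix x v"
  using assms suffix_length_suffix suffix_order.trans by blast

text \<open>The counts at the lengths \<open>k - 1\<close> and \<open>k\<close> determine the two ends of length \<open>k - 1\<close>. Conversely, the
counts at length \<open>k\<close> and the suffix give the counts at all smaller lengths, by extending occurrences
to the right until they reach length \<open>k\<close> or the end of the word.\<close>

lemma k_abelian_equiv_iff:
  fixes u v w w' :: "'a::finite list"
  assumes "k \<ge> 1" "length u = k - 1" "length v = k - 1" "prefix u w" "suffix v w"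
  shows "k_abelian_equiv k w w' \<longleftrightarrow>
    prefix u w' \<and> suffix v w' \<and> (\<forall>z. length z = k \<longrightarrow> occ w z = occ w' z)" (is "_ \<longleftrightarrow> ?R")
proof
  assume eq: "k_abelian_equiv k w w'"
  then have k: "occ w z = occ w' z" if "length z = k" for z
    using that assms(1) by (cases z) (auto simp: k_abelian_equiv_def)
  have short: "occ w x = occ w' x" if "length x = k - 1" "x \<noteq> []" for x
    using eq that unfolding k_abelian_equiv_def by auto
  have "prefix u w'"
  proof (cases "u = []")
    case False
    have "of_bool (prefix u w) = (of_bool (prefix u w') :: nat)"
      using occ_extend_left[of w u] occ_extend_left[of w' u] short[OF assms(2) False]
        k[of "a # u" for a] assms(1,2) by simp
    then show ?thesis using assms(4) by (simp split: if_splits add: of_bool_def)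
  qed simp
  moreover have "suffix v w'"
  proof (cases "v = []")
    case False
    have "of_bool (suffix v w) = (of_bool (suffix v w') :: nat)"
      using occ_extend_right[of w v] occ_extend_right[of w' v] short[OF assms(3) False]
        k[of "v @ [a]" for a] assms(1,3) by simp
    then show ?thesis using assms(5) by (simp split: if_splits add: of_bool_def)
  qed simp
  ultimately show ?R using k by blast
next
  assume R: ?R
  have "occ w x = occ w' x" if "length x \<le> k" for x
    using that
  proof (induction "k - length x" arbitrary: x)
    case 0
    then show ?case using R by simp
  next
    case (Suc n)
    then have "occ w (x @ [a]) = occ w' (x @ [a])" for a by simp
    moreover have "suffix x w \<longleftrightarrow> suffix x w'"
      using suffix_iff_common_suffix[of v w x] suffix_iff_common_suffix[of v w' x]
        assms(3,5) R Suc.hyps(2) by simp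
    ultimately show ?case
      using occ_extend_right[of w x] occ_extend_right[of w' x] by simp
  qed
  then show "k_abelian_equiv k w w'" by (simp add: k_abelian_equiv_def)
qed

section \<open>Words as walks in the de Bruijn graph\<close>

definition de_bruijn :: "nat \<Rightarrow> ('a list, 'a list) pre_digraph" where
  "de_bruijn k =
     \<lparr> verts = {x. length x = k - 1}, arcs = {z. length z = k}, tail = butlast, head = tl \<rparr>"

lemma de_bruijn_sel [simp]: "tail (de_bruijn k) = butlast" "head (de_bruijn k) = tl"
  by (simp_all add: de_bruijn_def)

abbreviation "db_cas k \<equiv> pre_digraph.cas (de_bruijn k)"
abbreviation "db_trails k \<equiv> pre_digraph.trails (de_bruijn k)"

text \<open>The word read along a walk that starts at the vertex \<open>u\<close>: each arc appends its last letter.\<close>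

definition spell :: "'a list \<Rightarrow> 'a list list \<Rightarrow> 'a list" where
  "spell u es = u @ map last es"

lemma spell_Nil [simp]: "spell u [] = u"
  by (simp add: spell_def)

text \<open>Induction along a walk has to peel off the first letter of the word, whereas \<open>spell\<close> appends at the
end; this equation reconciles the two.\<close>

lemma spell_step:
  assumes "e \<noteq> []"
  shows "spell (butlast e) (e # es) = hd e # spell (tl e) es"
  using append_butlast_last_id[OF assms] assms by (cases e) (auto simp: spell_def)

lemmas db_cas_simps [simp] = pre_digraph.cas.simps

lemma suffix_Cons_if_longer:
  "length v \<le> length w \<Longrightarrow> suffix v (a # w) \<longleftrightarrow> suffix v w"
  by (auto simp: suffix_Cons)

text \<open>The arcs of a walk are exactly the windows of length \<open>k\<close> of its word, in order.\<close>

lemma spell_of_walk: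
  assumes "k \<ge> 1" "length u = k - 1" "db_cas k u es v" "\<forall>e\<in>set es. length e = k"
  shows "suffix v (spell u es)"
    and "length z = k \<Longrightarrow> occ (spell u es) z = count_list es z"
proof -
  have "suffix v (spell u es) \<and> (length z = k \<longrightarrow> occ (spell u es) z = count_list es z)"
    using assms(2-4)
  proof (induction es arbitrary: u)
    case Nil
    have "\<not> sublist z u" if "length z = k"
      using that assms(1) Nil.prems(1) sublist_length_le[of z u] by auto
    then show ?case using Nil occ_pos_iff[of u z] by auto
  next
    case (Cons e es)
    then have e: "length e = k" "butlast e = u" by auto
    with assms(1) have "e \<noteq> []" by auto
    then have sp: "spell u (e # es) = hd e # spell (tl e) es"
      using e spell_step by metis
    have IH: "suffix v (spell (tl e) es)"
      "length z = k \<longrightarrow> occ (spell (tl e) es) z = count_list es z"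
      using Cons.IH[of "tl e"] Cons.prems e by auto
    have "prefix z (hd e # spell (tl e) es) \<longleftrightarrow> e = z" if "length z = k"
    proof -
      have "hd e # spell (tl e) es = e @ map last es"
        using \<open>e \<noteq> []\<close> by (simp add: spell_def)
      then show ?thesis using that e(1) by (auto simp: prefix_def append_eq_append_conv)
    qed
    then show ?case unfolding sp using IH by (auto simp: occ_Cons suffix_Cons)
  qed
  then show "suffix v (spell u es)" "length z = k \<Longrightarrow> occ (spell u es) z = count_list es z"
    by auto
qed

lemma walk_of_word:
  assumes "k \<ge> 1" "length u = k - 1" "length v = k - 1" "prefix u w" "suffix v w"
  obtains es where "db_cas k u es v" "\<forall>e\<in>set es. length e = k" "spell u es = w"
proof -
  obtain s where w: "w = u @ s" using assms(4) by (auto simp: prefix_def)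
  have "\<exists>es. db_cas k u es v \<and> (\<forall>e\<in>set es. length e = k) \<and> spell u es = u @ s"
    using assms(2,5) unfolding w
  proof (induction s arbitrary: u)
    case Nil
    then have "v = u" using assms(3) by (auto simp: suffix_def)
    then show ?case by (intro exI[of _ "[]"]) simp
  next
    case (Cons a s)
    define e where "e = u @ [a]"
    have e: "length e = k" "butlast e = u" "e \<noteq> []"
      using Cons.prems assms(1) by (auto simp: e_def)
    have word: "u @ a # s = hd e # tl e @ s" using e(3) by (cases e) (auto simp: e_def)
    have len: "length (tl e) = k - 1" using e(1) by simp
    then have "suffix v (tl e @ s)"
      using Cons.prems(2) assms(3) unfolding word by (subst (asm) suffix_Cons_if_longer) auto
    from Cons.IH[OF len this] obtain es where
      "db_cas k (tl e) es v" "\<forall>e\<in>set es. length e = k" "spell (tl e) es = tl e @ s" by blast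
    then show ?case
      using e spell_step[OF e(3), of es] word by (intro exI[of _ "e # es"]) auto
  qed
  then show ?thesis using that w by blast
qed

lemma spell_inj:
  assumes "k \<ge> 1" "db_cas k u es v" "db_cas k u fs v'"
    "\<forall>e\<in>set es. e \<noteq> []" "\<forall>e\<in>set fs. e \<noteq> []" "spell u es = spell u fs"
  shows "es = fs"
  using assms(2-)
proof (induction es arbitrary: u fs)
  case Nil
  then show ?case by (simp add: spell_def)
next
  case (Cons e es)
  then obtain f gs where fs: "fs = f # gs" by (cases fs) (auto simp: spell_def)
  have "butlast e = butlast f" "last e = last f" "e \<noteq> []" "f \<noteq> []"
    using Cons.prems unfolding fs by (auto simp: spell_def)
  then have "e = f" by (metis append_butlast_last_id)
  then show ?case using Cons unfolding fs by (auto simp: spell_def)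
qed

section \<open>The multigraph of a word\<close>

lemma card_labelled_copies:
  "card {(z, i). P z \<and> i < count M z} = size {#z \<in># M. P z#}"
proof -
  have "{(z, i). P z \<and> i < count M z} = (SIGMA z:{z. z \<in># M \<and> P z}. {..<count M z})"
    by (auto simp flip: count_greater_zero_iff)
  then show ?thesis by (simp add: size_filter_mset_eq_sum)
qed

lemma word_multigraph_degrees:
  assumes "\<And>z. f z = count M z" "\<And>z. z \<in># M \<Longrightarrow> length z = k"
  shows "out_degree (word_multigraph k f) x = pre_digraph.outdeg (de_bruijn k) M x"
    and "arc_mult (word_multigraph k f) x y = pre_digraph.arcs_between (de_bruijn k) M x y"
proof -
  have len: "length z = k" if "i < f z" for i z
    using that assms(1)[of z] assms(2)[of z] by (metis count_eq_zero_iff not_less_zero)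
  have "out_arcs (word_multigraph k f) x = {(z, i). butlast z = x \<and> i < count M z}"
    using len by (auto simp: word_multigraph_def out_arcs_def assms(1))
  then show "out_degree (word_multigraph k f) x = pre_digraph.outdeg (de_bruijn k) M x"
    by (simp add: out_degree_def card_labelled_copies pre_digraph.outdeg_def)
  have "{e \<in> arcs (word_multigraph k f). tail (word_multigraph k f) e = x \<and> head (word_multigraph k f) e = y} =
      {(z, i). (butlast z = x \<and> tl z = y) \<and> i < count M z}"
    using len by (auto simp: word_multigraph_def assms(1))
  then show "arc_mult (word_multigraph k f) x y = pre_digraph.arcs_between (de_bruijn k) M x y"
    by (simp only: arc_mult_def card_labelled_copies pre_digraph.arcs_between_def de_bruijn_sel)
qed

text \<open>A word that has length at least \<open>k\<close> has no factor of length \<open>k - 1\<close> that cannot be extended by a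
letter on one of its sides.\<close>

lemma verts_word_multigraph:
  assumes "k \<ge> 1" "length w \<ge> k"
  shows "verts (word_multigraph k (parikh k w)) = factors (k - 1) w"
proof (intro equalityI subsetI)
  fix x assume "x \<in> verts (word_multigraph k (parikh k w))"
  then obtain z where "length x = k - 1" "sublist z w" "prefix x z \<or> suffix x z"
    by (auto simp: word_multigraph_def parikh_def occ_pos_iff split: if_splits)
  then show "x \<in> factors (k - 1) w"
    unfolding factors_def by (auto intro: sublist_order.order.trans prefix_imp_sublist suffix_imp_sublist)
next
  fix x assume "x \<in> factors (k - 1) w"
  then obtain p s where x: "length x = k - 1" and w: "w = p @ x @ s"
    by (auto simp: factors_def sublist_def)
  have "\<exists>z. length z = k \<and> sublist z w \<and> (prefix x z \<or> suffix x z)"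
  proof (cases s)
    case Nil
    then have "p \<noteq> []" using w x assms by auto
    then obtain p' a where "p = p' @ [a]" by (meson rev_exhaust)
    then have "suffix (a # x) w" using w Nil by (simp add: suffix_def)
    then show ?thesis using x assms(1)
      by (intro exI[of _ "a # x"]) (auto simp: suffix_Cons)
  next
    case (Cons a s')
    then show ?thesis using w x assms
      by (intro exI[of _ "x @ [a]"]) (auto simp: sublist_def)
  qed
  then show "x \<in> verts (word_multigraph k (parikh k w))"
    using x by (auto simp: word_multigraph_def parikh_def occ_pos_iff)
qed

lemma outdeg_de_bruijn:
  fixes M :: "'a::finite list multiset"
  assumes "k \<ge> 1" "\<And>z. z \<in># M \<Longrightarrow> length z = k" "length x = k - 1"
  shows "pre_digraph.outdeg (de_bruijn k) M x = (\<Sum>a\<in>UNIV. count M (x @ [a]))"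
proof -
  have "pre_digraph.outdeg (de_bruijn k) M x = (\<Sum>z | z \<in># M \<and> butlast z = x. count M z)"
    by (simp add: pre_digraph.outdeg_def size_filter_mset_eq_sum)
  also have "\<dots> = (\<Sum>z\<in>range (\<lambda>a. x @ [a]). count M z)"
  proof (rule sum.mono_neutral_left)
    show "{z. z \<in># M \<and> butlast z = x} \<subseteq> range (\<lambda>a. x @ [a])"
    proof clarify
      fix z assume "z \<in># M"
      then have "z \<noteq> []" using assms(1,2) by fastforce
      then show "z \<in> range (\<lambda>a. butlast z @ [a])"
        by (metis append_butlast_last_id rangeI)
    qed
  qed (auto simp: not_in_iff)
  also have "\<dots> = (\<Sum>a\<in>UNIV. count M (x @ [a]))"
    by (subst sum.reindex) (auto simp: inj_on_def)
  finally show ?thesis .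
qed

lemma parallel_orders_de_bruijn:
  fixes M :: "'a::finite list multiset"
  assumes "k \<ge> 1" "finite V" "\<And>z. z \<in># M \<Longrightarrow> length z = k \<and> butlast z \<in> V"
  shows "parallel_orders M = (\<Prod>x\<in>V. \<Prod>a\<in>UNIV. fact (count M (x @ [a])))"
proof -
  let ?f = "\<lambda>(x, a). x @ [a]"
  have "parallel_orders M = (\<Prod>z\<in>?f ` (V \<times> UNIV). fact (count M z))"
    unfolding parallel_orders_def
  proof (rule prod.mono_neutral_left)
    show "set_mset M \<subseteq> ?f ` (V \<times> UNIV)"
    proof
      fix z assume z: "z \<in># M"
      then have "z \<noteq> []" using assms(1) assms(3)[OF z] by auto
      then show "z \<in> ?f ` (V \<times> UNIV)"
        using assms(3)[OF z] by (intro image_eqI[of _ _ "(butlast z, last z)"]) auto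
    qed
  qed (use assms(2) in \<open>auto simp: not_in_iff\<close>)
  also have "\<dots> = (\<Prod>x\<in>V. \<Prod>a\<in>UNIV. fact (count M (x @ [a])))"
    by (subst prod.reindex) (auto simp: inj_on_def prod.cartesian_product intro!: prod.cong)
  finally show ?thesis .
qed

text \<open>The class fixes the two ends of length \<open>k - 1\<close> and the multiset of windows of length \<open>k\<close>. In terms of
walks these are the two end vertices and the multiset of arcs.\<close>

lemma k_abelian_class_eq_trails:
  fixes u v w :: "'a::finite list"
  assumes "k \<ge> 1" "length u = k - 1" "length v = k - 1" "prefix u w" "suffix v w"
    and M: "\<And>z. z \<in># M \<Longrightarrow> length z = k" "\<And>z. length z = k \<Longrightarrow> occ w z = count M z"
  shows "bij_betw (spell u) (db_trails k M u v) (k_abelian_class k w)"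
  unfolding bij_betw_def
proof
  note trails = pre_digraph.trails_def
  have len: "\<forall>e\<in>set es. length e = k" if "es \<in> db_trails k M u v" for es
    using that M(1) by (auto simp: trails)
  then show "inj_on (spell u) (db_trails k M u v)"
    using assms(1) by (intro inj_onI spell_inj[OF assms(1)]) (fastforce simp: trails)+
  have "spell u es \<in> k_abelian_class k w" if es: "es \<in> db_trails k M u v" for es
  proof -
    have cas: "db_cas k u es v" "mset es = M" using es by (auto simp: trails)
    show ?thesis
      using spell_of_walk[OF assms(1,2) cas(1) len[OF es]] k_abelian_equiv_iff[OF assms(1-5)] M(2) cas(2)
      by (auto simp: k_abelian_class_def spell_def count_mset)
  qed
  moreover have "w' \<in> spell u ` db_trails k M u v" if "w' \<in> k_abelian_class k w" for w'
  proof -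
    have w': "prefix u w'" "suffix v w'" and occ: "\<And>z. length z = k \<Longrightarrow> occ w z = occ w' z"
      using that k_abelian_equiv_iff[OF assms(1-5)] by (auto simp: k_abelian_class_def)
    obtain es where es: "db_cas k u es v" "\<forall>e\<in>set es. length e = k" "spell u es = w'"
      using walk_of_word[OF assms(1-3) w'] .
    have "mset es = M"
    proof (rule multiset_eqI)
      fix z show "count (mset es) z = count M z"
      proof (cases "length z = k")
        case True
        then show ?thesis
          using spell_of_walk(2)[OF assms(1,2) es(1,2) True] es(3) occ M(2) by (simp add: count_mset)
      next
        case False
        then have "z \<notin> set es" "z \<notin># M" using es(2) M(1) by auto
        then show ?thesis by (simp add: not_in_iff count_mset count_list_0_iff)
      qed
    qed
    then show ?thesis using es by (auto simp: trails)
  qed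
  ultimately show "spell u ` db_trails k M u v = k_abelian_class k w" by blast
qed

section \<open>The size of a k-abelian class\<close>

theorem proposition4p7:
  fixes k :: nat and u v w :: "'a::finite list"
    and G :: "('a list, 'a list \<times> nat) pre_digraph"
    and vs :: "'a list list" and i :: nat
  assumes "k \<ge> 1"
    and "length u = k - 1" and "length v = k - 1"
    and "length w \<ge> k" and "prefix u w" and "suffix v w"
    and "G = word_multigraph k (parikh k w)"
    and "distinct vs" and "set vs = verts G"
    and "i < length vs" and "vs ! i = v"
  shows "rat_of_nat (card (k_abelian_class k w)) =
           rat_of_int (det (mat_delete (laplacian_mat G vs) i i)) *
           (\<Prod>x\<in>factors (k - 1) w.
              fact (occ w x - 1) / (\<Prod>a\<in>(UNIV :: 'a set). fact (occ w (x @ [a]))))"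
proof -
  interpret B: pre_digraph "de_bruijn k :: ('a list, 'a list) pre_digraph" .
  obtain es where es: "B.cas u es v" "\<forall>e\<in>set es. length e = k" "spell u es = w"
    using walk_of_word[OF assms(1-3,5,6)] .
  define M where "M = mset es"
  have len: "length z = k" if "z \<in># M" for z
    using that es(2) by (simp add: M_def)
  have occ: "occ w z = count M z" if "length z = k" for z
    using spell_of_walk(2)[OF assms(1,2) es(1,2) that] es(3) by (simp add: M_def count_mset)
  have parikh: "parikh k w z = count M z" for z
    using occ[of z] len[of z] by (auto simp: parikh_def count_eq_zero_iff)
  have V: "set vs = factors (k - 1) w"
    using assms(9) verts_word_multigraph[OF assms(1,4)] by (simp add: assms(7))
  then have lenV: "length x = k - 1" if "x \<in> set vs" for x
    using that by (simp add: factors_def)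
  have "u \<in> set vs" "v \<in> set vs"
    using assms(2,3,5,6) by (auto simp: V factors_def)
  have ends: "tail (de_bruijn k) e \<in> set vs \<and> head (de_bruijn k) e \<in> set vs" if "e \<in># M" for e
  proof -
    have "sublist e w" using that occ[OF len[OF that]] by (simp flip: occ_pos_iff)
    then show ?thesis
      using len[OF that] by (auto simp: V factors_def
          intro: sublist_order.order.trans sublist_butlast sublist_tl)
  qed
  \<comment> \<open>The final occurrence of \<open>v\<close> is the only one that is not followed by a letter. This is why the
    same expression \<open>occ w x - 1\<close> gives the outdegree at \<open>v\<close> and one less than it elsewhere.\<close>
  have outdeg: "occ w x = B.outdeg M x + of_bool (x = v)" if "x \<in> set vs" for x
  proof -
    have "suffix x w \<longleftrightarrow> x = v"
      using assms(3,6) lenV[OF that] by (metis suffix_length_suffix suffix_order.antisym order_refl)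
    then show ?thesis
      using occ_extend_right[of w x] outdeg_de_bruijn[OF assms(1) len lenV[OF that]]
        occ[of "x @ [a]" for a] lenV[OF that] assms(1) by simp
  qed
  \<comment> \<open>So the rooted Laplacian differs from the Laplacian only in the row of \<open>v\<close>.\<close>
  have exits: "B.outdeg M x > 0" if "x \<in> set vs" "x \<noteq> v" for x
    using outdeg[OF that(1)] that occ_pos_iff[of w x] by (simp add: V factors_def)

  have "card (k_abelian_class k w) = card (B.trails M u v)"
    using bij_betw_same_card[OF k_abelian_class_eq_trails[OF assms(1-3,5,6) len occ]] by simp
  moreover have "det (B.rooted_laplacian_mat M v vs) = det (mat_delete (laplacian_mat G vs) i i)"
  proof (rule B.det_rooted_laplacian_mat[OF assms(8,10,11)])
    fix k' l assume *: "k' < length vs" "l < length vs" "k' \<noteq> i"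
    then have "vs ! k' \<noteq> v" "B.outdeg M (vs ! k') > 0"
      using assms(8,10,11) exits[of "vs ! k'"] by (auto simp: nth_eq_iff_index_eq)
    then show "B.rooted_laplacian M v (vs ! k') (vs ! l) = laplacian_mat G vs $$ (k', l)"
      using * word_multigraph_degrees[OF parikh len]
      by (simp add: laplacian_mat_def laplacian_def B.rooted_laplacian_def assms(7))
  qed (simp add: laplacian_mat_def)
  moreover have "B.exit_orders (set vs) M v = (\<Prod>x\<in>set vs. fact (occ w x - 1))"
    unfolding B.exit_orders_def
    by (subst prod.remove[of "set vs" v "\<lambda>x. fact (occ w x - 1)"]) (use \<open>v \<in> set vs\<close> in \<open>auto simp: outdeg intro!: prod.cong\<close>)
  moreover have "parallel_orders M = (\<Prod>x\<in>set vs. \<Prod>a\<in>UNIV. fact (occ w (x @ [a])))"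
    using parallel_orders_de_bruijn[OF assms(1) finite_set, of M vs] len ends lenV occ assms(1)
    by (simp cong: prod.cong)
  ultimately have "int (card (k_abelian_class k w)) *
      (\<Prod>x\<in>set vs. \<Prod>a\<in>UNIV. fact (occ w (x @ [a]))) =
      det (mat_delete (laplacian_mat G vs) i i) * (\<Prod>x\<in>set vs. fact (occ w x - 1))"
    using B.card_trails_formula[OF assms(8) \<open>u \<in> set vs\<close> \<open>v \<in> set vs\<close> ends, of M]
      B.cas_imp_balanced[OF es(1)] by (simp add: M_def)
  then have "rat_of_int (int (card (k_abelian_class k w)) *
      (\<Prod>x\<in>set vs. \<Prod>a\<in>UNIV. fact (occ w (x @ [a])))) =
      rat_of_int (det (mat_delete (laplacian_mat G vs) i i) * (\<Prod>x\<in>set vs. fact (occ w x - 1)))"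
    by (rule arg_cong)
  then show ?thesis
    unfolding V[symmetric] prod_dividef by (simp add: field_simps)
qed

end
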